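(* Let $\mathcal{H}$ be a complex Hilbert space, $T,S,X,Y\in\mathcal{B}(\mathcal{H})$, $\mu\in[0,1]$, $\alpha\in\mathbb{C}\setminus\{0\}$ and $\beta\ge0$. Then $$\begin{aligned}\omega^4\left(\begin{bmatrix}T&X\\ Y&S\end{bmatrix}\right)\le{}&(2+2\chi_1+2\chi_3)\max\left\{\left\||T|^4+|X^*|^4\right\|,\left\||S|^4+|Y^*|^4\right\|\right\}\\&+(2\chi_2+2\mu\chi_4)\max\left\{\left\||T|^2+|X^*|^2\right\|,\left\||S|^2+|Y^*|^2\right\|\right\}\omega\left(\begin{bmatrix}0&XS\\ YT&0\end{bmatrix}\right)\\&+\left(4+4(1-\mu)\chi_4\right)\omega^2\left(\begin{bmatrix}0&XS\\ YT&0\end{bmatrix}\right),\end{aligned}$$ where $\chi_1=\frac{\beta+(\beta+1)\max\{1,|\alpha-1|^2\}}{|\alpha|^2(\beta+1)}$, $\chi_2=\frac{1+2(\beta+1)\max\{1,|\alpha-1|\}}{|\alpha|^2(\beta+1)}$, $\chi_3=\frac{2\beta+2(\beta+1)\max\{1,|\alpha-1|^2\}}{|\alpha|^2(\beta+1)}$ and $\chi_4=\frac{2}{|\alpha|^2(\beta+1)}$.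
   Context: $\mathcal{B}(\mathcal{H})$ is the algebra of bounded linear operators on $\mathcal{H}$, $\|\cdot\|$ is the operator norm, and $2\times2$ operator matrices act on $\mathcal{H}\oplus\mathcal{H}$. The numerical radius of a bounded operator $A$ on a complex Hilbert space is $\omega(A)=\sup_{\|x\|=1}|\langle Ax,x\rangle|$, and $\omega^s(A)=(\omega(A))^s$. $|A|=(A^*A)^{1/2}$. *)

theory Defs
  imports "HOL-Analysis.Analysis"
begin

text \<open>A complex inner product space is rendered as a real inner product space (whose real inner
  product is the real part of the complex one) carrying a complex scalar multiplication and a
  sesquilinear form. Norm, metric and topology are those of class \<open>real_inner\<close>, so that
  \<open>norm x\<close> is the square root of \<open>cinner x x\<close>. The form is linear in its first argument.\<close>

class complex_inner = real_inner +
  fixes scaleC :: "complex \<Rightarrow> 'a \<Rightarrow> 'a"  (infixr \<open>*\<^sub>C\<close> 75)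
    and cinner :: "'a \<Rightarrow> 'a \<Rightarrow> complex"
  assumes scaleC_add_right: "a *\<^sub>C (x + y) = a *\<^sub>C x + a *\<^sub>C y"
    and scaleC_add_left: "(a + b) *\<^sub>C x = a *\<^sub>C x + b *\<^sub>C x"
    and scaleC_scaleC: "a *\<^sub>C (b *\<^sub>C x) = (a * b) *\<^sub>C x"
    and scaleR_scaleC: "r *\<^sub>R x = complex_of_real r *\<^sub>C x"
    and cinner_commute: "cinner x y = cnj (cinner y x)"
    and cinner_add_left: "cinner (x + y) z = cinner x z + cinner y z"
    and cinner_scaleC_left: "cinner (a *\<^sub>C x) y = a * cinner x y"
    and inner_eq_Re_cinner: "inner x y = Re (cinner x y)"

lemma cinner_self:
  fixes x :: "'a :: complex_inner"
  shows "cinner x x = complex_of_real ((norm x)\<^sup>2)"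
proof (rule complex_eqI)
  show "Re (cinner x x) = Re (complex_of_real ((norm x)\<^sup>2))"
    by (simp add: inner_eq_Re_cinner [symmetric] power2_norm_eq_inner)
  have "Im (cinner x x) = - Im (cinner x x)"
    by (metis cinner_commute cnj.simps(2))
  then show "Im (cinner x x) = Im (complex_of_real ((norm x)\<^sup>2))"
    by simp
qed

class chilbert_space = complex_inner + complete_space

text \<open>The Hilbert space direct sum of two spaces is the product type, with the norm
  \<open>sqrt ((norm x)\<^sup>2 + (norm y)\<^sup>2)\<close> it already has in the library.\<close>

instantiation prod :: (complex_inner, complex_inner) complex_inner
begin

definition scaleC_prod :: "complex \<Rightarrow> 'a \<times> 'b \<Rightarrow> 'a \<times> 'b"
  where "scaleC_prod c z = (c *\<^sub>C fst z, c *\<^sub>C snd z)"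

definition cinner_prod :: "'a \<times> 'b \<Rightarrow> 'a \<times> 'b \<Rightarrow> complex"
  where "cinner_prod z w = cinner (fst z) (fst w) + cinner (snd z) (snd w)"

instance
proof
  fix a b :: complex and r :: real and x y z :: "'a \<times> 'b"
  show "a *\<^sub>C (x + y) = a *\<^sub>C x + a *\<^sub>C y"
    by (simp add: scaleC_prod_def scaleC_add_right)
  show "(a + b) *\<^sub>C x = a *\<^sub>C x + b *\<^sub>C x"
    by (simp add: scaleC_prod_def scaleC_add_left)
  show "a *\<^sub>C (b *\<^sub>C x) = (a * b) *\<^sub>C x"
    by (simp add: scaleC_prod_def scaleC_scaleC)
  show "r *\<^sub>R x = complex_of_real r *\<^sub>C x"
    by (simp add: scaleC_prod_def scaleR_prod_def scaleR_scaleC)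
  show "cinner x y = cnj (cinner y x)"
    unfolding cinner_prod_def complex_cnj_add
    by (simp only: cinner_commute [symmetric])
  show "cinner (x + y) z = cinner x z + cinner y z"
    by (simp add: cinner_prod_def cinner_add_left)
  show "cinner (a *\<^sub>C x) y = a * cinner x y"
    by (simp add: cinner_prod_def scaleC_prod_def cinner_scaleC_left distrib_left)
  show "inner x y = Re (cinner x y)"
    by (simp add: cinner_prod_def inner_prod_def inner_eq_Re_cinner)
qed

end

instance prod :: (chilbert_space, chilbert_space) chilbert_space ..

definition bounded_clinear :: "('a :: complex_inner \<Rightarrow> 'b :: complex_inner) \<Rightarrow> bool"
  where "bounded_clinear A \<longleftrightarrow> bounded_linear A \<and> (\<forall>c x. A (c *\<^sub>C x) = c *\<^sub>C A x)"

definition cadjoint :: "('a :: chilbert_space \<Rightarrow> 'a) \<Rightarrow> 'a \<Rightarrow> 'a"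
  where "cadjoint A = (THE B. bounded_clinear B \<and> (\<forall>x y. cinner (A x) y = cinner x (B y)))"

definition positive_op :: "('a :: chilbert_space \<Rightarrow> 'a) \<Rightarrow> bool"
  where "positive_op P \<longleftrightarrow> bounded_clinear P \<and> (\<forall>x. cinner (P x) x \<in> \<real>\<^sub>\<ge>\<^sub>0)"

definition op_sqrt :: "('a :: chilbert_space \<Rightarrow> 'a) \<Rightarrow> 'a \<Rightarrow> 'a"
  where "op_sqrt A = (THE P. positive_op P \<and> P \<circ> P = A)"

definition op_abs :: "('a :: chilbert_space \<Rightarrow> 'a) \<Rightarrow> 'a \<Rightarrow> 'a"
  where "op_abs A = op_sqrt (cadjoint A \<circ> A)"

text \<open>The supremum is taken in \<open>[0, \<infinity>)\<close>: on the zero space, which has no unit vectors, the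
  numerical radius is 0 (in type \<open>real\<close> the supremum of the empty set would be unspecified).\<close>

definition numerical_radius :: "('a :: chilbert_space \<Rightarrow> 'a) \<Rightarrow> real"
  where "numerical_radius A =
    (if \<exists>x :: 'a. norm x = 1 then SUP x \<in> {x. norm x = 1}. cmod (cinner (A x) x) else 0)"

definition op_matrix ::
    "('a :: chilbert_space \<Rightarrow> 'a) \<Rightarrow> ('a \<Rightarrow> 'a) \<Rightarrow> ('a \<Rightarrow> 'a) \<Rightarrow> ('a \<Rightarrow> 'a) \<Rightarrow> 'a \<times> 'a \<Rightarrow> 'a \<times> 'a"
  where "op_matrix A B C D = (\<lambda>(x, y). (A x + B y, C x + D y))"

end

theory Submission
  imports Defs
begin

text \<open>For a unit vector \<open>z = (x, y)\<close> put \<open>a = (T x, S y)\<close> and \<open>b = (Y\<^sup>* y, X\<^sup>* x)\<close>. The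
  quadratic form of the operator matrix at \<open>z\<close> is \<open>\<langle>a, z\<rangle> + \<langle>z, b\<rangle>\<close>, and \<open>\<langle>a, b\<rangle>\<close> is the
  quadratic form of the off-diagonal matrix with entries \<open>XS\<close>, \<open>YT\<close>. With \<open>p = |\<langle>a, z\<rangle>|\<close> and
  \<open>q = |\<langle>z, b\<rangle>|\<close> one has \<open>(p + q)\<^sup>4 \<le> 2 (p\<^sup>2 + q\<^sup>2)\<^sup>2 + 8 (p q)\<^sup>2\<close>. The first summand is controlled
  by the Frobenius norm of the Gram matrix of \<open>a\<close> and \<open>b\<close>; half of the second is bounded with
  \<open>\<chi>1, \<chi>2\<close> and the other half with \<open>\<chi>3, \<chi>4\<close>, both by squaring the generalized Buzano inequality
  \<open>|\<alpha>| p q \<le> max 1 |\<alpha> - 1| \<parallel>a\<parallel> \<parallel>b\<parallel> + |\<langle>a, b\<rangle>|\<close> and splitting \<open>|\<langle>a, b\<rangle>|\<^sup>2\<close> with weights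
  \<open>\<beta> / (\<beta> + 1)\<close> and \<open>1 / (\<beta> + 1)\<close>.\<close>

instance chilbert_space \<subseteq> banach ..

subsection \<open>Riesz representation\<close>

text \<open>The representing vector is the minimizer of \<open>J x = (norm x)^2 - 2 * f x\<close>.
  The parallelogram law makes minimizing sequences Cauchy, and comparing \<open>J\<close> at
  \<open>u\<close> and at \<open>u + t *\<^sub>R v\<close> identifies \<open>f v\<close>.\<close>

lemma riesz_representation_real:
  fixes f :: "'a :: {real_inner, banach} \<Rightarrow> real"
  assumes "bounded_linear f"
  shows "\<exists>u. \<forall>x. f x = inner u x"
proof -
  interpret f: bounded_linear f by fact
  define J where "J x = (norm x)\<^sup>2 - 2 * f x" for x
  obtain K where K: "\<And>x. norm (f x) \<le> norm x * K"
    using f.bounded by blast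
  have lower: "- K\<^sup>2 \<le> J x" for x
  proof -
    have "f x \<le> norm x * K" using K[of x] by simp
    moreover have "0 \<le> (norm x - K)\<^sup>2" by simp
    ultimately show ?thesis by (simp add: J_def power2_eq_square algebra_simps)
  qed
  then have bdd: "bdd_below (range J)" by (auto intro!: bdd_belowI)
  define m where "m = Inf (range J)"
  have m_le: "m \<le> J x" for x
    unfolding m_def using bdd by (auto intro: cInf_lower)
  have "\<exists>x. J x < m + 1 / real (Suc n)" for n
  proof -
    have "Inf (range J) < m + 1 / real (Suc n)" by (simp add: m_def)
    then show ?thesis using bdd by (subst (asm) cInf_less_iff) auto
  qed
  then obtain s where s: "\<And>n. J (s n) < m + 1 / real (Suc n)" by metis
  \<comment> \<open>The linear parts cancel here, so two points whose values of \<open>J\<close> are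
    close to the infimum must be close to each other.\<close>
  have parallelogram: "(norm (x - y))\<^sup>2 = 2 * J x + 2 * J y - 4 * J ((1/2) *\<^sub>R (x + y))" for x y
    unfolding J_def power2_norm_eq_inner
    by (simp add: f.scaleR f.add inner_simps inner_commute field_simps)
  have close: "(norm (s i - s j))\<^sup>2 < 4 / real (Suc n)" if "n \<le> i" "n \<le> j" for n i j
  proof -
    have "1 / real (Suc i) \<le> 1 / real (Suc n)" "1 / real (Suc j) \<le> 1 / real (Suc n)"
      using that by (simp_all add: field_simps)
    then show ?thesis
      using parallelogram[of "s i" "s j"] s[of i] s[of j] m_le[of "(1/2) *\<^sub>R (s i + s j)"]
      by linarith
  qed
  have "Cauchy s"
  proof (rule CauchyI)
    fix e :: real assume "0 < e"
    then obtain n where n: "4 / e\<^sup>2 < real (Suc n)"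
      using reals_Archimedean2[of "4 / e\<^sup>2"] by (metis less_SucI of_nat_less_iff order_less_trans lessI)
    then have "4 / real (Suc n) < e\<^sup>2" using \<open>0 < e\<close> by (simp add: field_simps)
    then have "norm (s i - s j) < e" if "n \<le> i" "n \<le> j" for i j
      using close[OF that] \<open>0 < e\<close> by (meson less_imp_le order_less_trans power_less_imp_less_base)
    then show "\<exists>M. \<forall>i\<ge>M. \<forall>j\<ge>M. norm (s i - s j) < e" by blast
  qed
  then obtain u where u: "s \<longlonglongrightarrow> u" by (auto simp: Cauchy_convergent_iff convergent_def)
  have "(\<lambda>n. J (s n)) \<longlonglongrightarrow> J u"
    unfolding J_def by (intro tendsto_intros f.tendsto u)
  moreover have "(\<lambda>n. m + 1 / real (Suc n)) \<longlonglongrightarrow> m + 0"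
    by (intro tendsto_intros LIMSEQ_Suc lim_1_over_n)
  ultimately have "J u \<le> m + 0"
    by (rule LIMSEQ_le) (use s less_imp_le in blast)
  then have min: "J u \<le> J x" for x using m_le[of x] by simp
  have "f v = inner u v" for v
  proof -
    define d where "d = inner u v - f v"
    have quad: "0 \<le> 2 * t * d + t\<^sup>2 * (norm v)\<^sup>2" for t
      using min[of "u + t *\<^sub>R v"]
      unfolding J_def power2_norm_eq_inner d_def
      by (simp add: f.scaleR f.add inner_simps inner_commute power2_eq_square algebra_simps)
    \<comment> \<open>The added 1 keeps the step \<open>t = - d / c\<close> meaningful for
      \<open>v = 0\<close>. At this \<open>t\<close> the quadratic is negative unless
      \<open>d = 0\<close>.\<close>
    define c where "c = (norm v)\<^sup>2 + 1"
    have "0 < c" by (simp add: c_def add_nonneg_pos)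
    have "0 \<le> 2 * (- d / c) * d + (- d / c)\<^sup>2 * (c - 1)"
      using quad[of "- d / c"] by (simp add: c_def)
    also have "\<dots> = - (d / c)\<^sup>2 * (c + 1)"
      using \<open>0 < c\<close> by (simp add: field_simps power2_eq_square)
    finally have "(d / c)\<^sup>2 * (c + 1) \<le> 0" by simp
    then have "d = 0" using \<open>0 < c\<close> by (simp add: mult_le_0_iff)
    then show ?thesis by (simp add: d_def)
  qed
  then show ?thesis by blast
qed

subsection \<open>Square roots of positive operators on a real Hilbert space\<close>

text \<open>Polarization: \<open>4 * inner (K x) y\<close> is a difference of two values of the
  quadratic form, bounded through the parallelogram law. Taking \<open>y\<close> parallel to
  \<open>K x\<close> and as long as \<open>x\<close> turns this into a bound on
  \<open>norm (K x)\<close>.\<close>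

lemma symmetric_norm_le:
  fixes K :: "'a :: real_inner \<Rightarrow> 'a"
  assumes "linear K" and sym: "\<And>x y. inner (K x) y = inner x (K y)"
    and le: "\<And>x. \<bar>inner (K x) x\<bar> \<le> (norm x)\<^sup>2"
  shows "norm (K x) \<le> norm x"
proof (cases "K x = 0")
  case False
  interpret K: linear K by fact
  define y where "y = (norm x / norm (K x)) *\<^sub>R K x"
  have ny: "norm y = norm x" using False by (simp add: y_def)
  have "4 * inner (K x) y = inner (K (x + y)) (x + y) - inner (K (x - y)) (x - y)"
    using sym[of y x] by (simp add: K.add K.diff inner_simps inner_commute)
  also have "\<dots> \<le> (norm (x + y))\<^sup>2 + (norm (x - y))\<^sup>2"
    using le[of "x + y"] le[of "x - y"] by linarith
  also have "\<dots> = 4 * (norm x)\<^sup>2"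
    using ny unfolding power2_norm_eq_inner norm_eq
    by (simp add: inner_simps inner_commute)
  finally have "inner (K x) y \<le> (norm x)\<^sup>2" by simp
  moreover have "inner (K x) y = norm x * norm (K x)"
    using False by (simp add: y_def flip: power2_norm_eq_inner) (simp add: power2_eq_square)
  ultimately have "norm x * norm (K x) \<le> norm x * norm x" by (simp add: power2_eq_square)
  moreover have "x \<noteq> 0" using False K.zero by auto
  ultimately show ?thesis by simp
qed simp

text \<open>The iterates converge to the fixed point \<open>Y = (K + Y\<^sup>2) / 2\<close>, for which \<open>(1 - Y)\<^sup>2 = 1 - K\<close>.
  They are majorized by the same iteration for the scalar 1, which increases and is bounded by 1.\<close>

primrec sqrt_iter :: "'a :: real_normed_vector \<Rightarrow>\<^sub>L 'a \<Rightarrow> nat \<Rightarrow> 'a \<Rightarrow>\<^sub>L 'a" where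
  "sqrt_iter K 0 = 0"
| "sqrt_iter K (Suc n) = (1/2) *\<^sub>R (K + (sqrt_iter K n o\<^sub>L sqrt_iter K n))"

primrec sqrt_iter_bound :: "nat \<Rightarrow> real" where
  "sqrt_iter_bound 0 = 0"
| "sqrt_iter_bound (Suc n) = (1 + (sqrt_iter_bound n)\<^sup>2) / 2"

lemma sqrt_iter_bound_range: "0 \<le> sqrt_iter_bound n \<and> sqrt_iter_bound n \<le> 1"
  by (induction n) (auto intro: power_le_one)

lemma sqrt_iter_bound_le_Suc: "sqrt_iter_bound n \<le> sqrt_iter_bound (Suc n)"
proof -
  have "0 \<le> (sqrt_iter_bound n - 1)\<^sup>2" by simp
  then show ?thesis by (simp add: power2_eq_square algebra_simps)
qed

lemma norm_sqrt_iter_le: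
  assumes "norm K \<le> 1"
  shows "norm (sqrt_iter K n) \<le> sqrt_iter_bound n"
proof (induction n)
  case (Suc n)
  have "norm (sqrt_iter K n o\<^sub>L sqrt_iter K n) \<le> norm (sqrt_iter K n) * norm (sqrt_iter K n)"
    by (rule norm_blinfun_compose)
  also have "\<dots> \<le> (sqrt_iter_bound n)\<^sup>2"
    using Suc by (simp add: power2_eq_square mult_mono')
  finally show ?case
    using assms norm_triangle_ineq[of K "sqrt_iter K n o\<^sub>L sqrt_iter K n"] by simp
qed simp

text \<open>The difference of squares is written as \<open>A (A - B) + (A - B) B\<close>, valid
  without commutativity. Its norm is then dominated by the corresponding scalar difference of
  squares.\<close>

lemma norm_sqrt_iter_diff_le:
  assumes "norm K \<le> 1"
  shows "norm (sqrt_iter K (Suc n) - sqrt_iter K n) \<le> sqrt_iter_bound (Suc n) - sqrt_iter_bound n"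
proof (induction n)
  case 0
  then show ?case using assms by simp
next
  case (Suc n)
  let ?A = "sqrt_iter K (Suc n)" and ?B = "sqrt_iter K n"
  let ?a = "sqrt_iter_bound (Suc n)" and ?b = "sqrt_iter_bound n"
  have half: "(1/2) *\<^sub>R (K + U) - (1/2) *\<^sub>R (K + V) = (1/2) *\<^sub>R (U - V)" for U V
    by (simp add: algebra_simps)
  have "sqrt_iter K (Suc (Suc n)) - ?A = (1/2) *\<^sub>R ((?A o\<^sub>L ?A) - (?B o\<^sub>L ?B))"
    using half[of "?A o\<^sub>L ?A" "?B o\<^sub>L ?B"]
    by (simp only: sqrt_iter.simps(2)[of K "Suc n", symmetric] sqrt_iter.simps(2)[of K n, symmetric])
  also have "(?A o\<^sub>L ?A) - (?B o\<^sub>L ?B) = (?A o\<^sub>L (?A - ?B)) + ((?A - ?B) o\<^sub>L ?B)"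
    by (simp del: sqrt_iter.simps add:
        bounded_bilinear.diff_left[OF bounded_bilinear_blinfun_compose]
        bounded_bilinear.diff_right[OF bounded_bilinear_blinfun_compose])
  finally have "sqrt_iter K (Suc (Suc n)) - ?A = (1/2) *\<^sub>R ((?A o\<^sub>L (?A - ?B)) + ((?A - ?B) o\<^sub>L ?B))" .
  moreover have "norm (?A o\<^sub>L (?A - ?B)) \<le> ?a * (?a - ?b)"
    by (rule order_trans[OF norm_blinfun_compose])
      (intro mult_mono Suc.IH norm_sqrt_iter_le[OF assms] norm_ge_zero
        conjunct1[OF sqrt_iter_bound_range])
  moreover have "norm ((?A - ?B) o\<^sub>L ?B) \<le> (?a - ?b) * ?b"
    by (rule order_trans[OF norm_blinfun_compose])
      (intro mult_mono Suc.IH norm_sqrt_iter_le[OF assms] norm_ge_zero,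
       use sqrt_iter_bound_le_Suc[of n] in linarith)
  ultimately have "norm (sqrt_iter K (Suc (Suc n)) - ?A) \<le> (?a * (?a - ?b) + (?a - ?b) * ?b) / 2"
    using norm_triangle_ineq[of "?A o\<^sub>L (?A - ?B)" "(?A - ?B) o\<^sub>L ?B"] by simp
  also have "\<dots> = (1 + ?a\<^sup>2) / 2 - (1 + ?b\<^sup>2) / 2"
    by (simp only: power2_eq_square) argo
  finally show ?case by (simp del: sqrt_iter.simps)
qed

text \<open>The scalar increments telescope along a bounded increasing sequence, hence are summable,
  and they dominate the operator increments.\<close>

lemma convergent_sqrt_iter:
  fixes K :: "'a :: banach \<Rightarrow>\<^sub>L 'a"
  assumes "norm K \<le> 1"
  shows "convergent (sqrt_iter K)"
proof -
  have "incseq sqrt_iter_bound" by (rule incseq_SucI) (rule sqrt_iter_bound_le_Suc)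
  then obtain l where "sqrt_iter_bound \<longlonglongrightarrow> l"
    using incseq_convergent[of sqrt_iter_bound 1] sqrt_iter_bound_range by blast
  then have "summable (\<lambda>n. sqrt_iter_bound (Suc n) - sqrt_iter_bound n)"
    by (rule telescope_summable)
  then have "summable (\<lambda>n. sqrt_iter K (Suc n) - sqrt_iter K n)"
    by (rule summable_comparison_test'[where N = 0]) (rule norm_sqrt_iter_diff_le[OF assms])
  then have "(\<lambda>n. sqrt_iter K n - sqrt_iter K 0) \<longlonglongrightarrow> (\<Sum>n. sqrt_iter K (Suc n) - sqrt_iter K n)"
    unfolding sum_lessThan_telescope[symmetric] by (rule summable_LIMSEQ)
  then show ?thesis by (auto simp: convergent_def)
qed


text \<open>With \<open>k = 1 - A / c\<close> and \<open>Y\<close> the limit of the iteration for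
  \<open>k\<close>, the root is \<open>sqrt c\<close> times \<open>1 - Y\<close>. The iterates are
  polynomials in \<open>k\<close>, so whatever commutes with \<open>A\<close> commutes with them and
  with the limit. This commutation later yields complex linearity and uniqueness.\<close>

lemma symmetric_positive_sqrt:
  fixes A :: "'a :: {real_inner, banach} \<Rightarrow> 'a"
  assumes A: "bounded_linear A" and sym: "\<And>x y. inner (A x) y = inner x (A y)"
    and pos: "\<And>x. 0 \<le> inner (A x) x"
  obtains P where "bounded_linear P" "\<And>x y. inner (P x) y = inner x (P y)"
    "\<And>x. 0 \<le> inner (P x) x" "\<And>x. P (P x) = A x"
    "\<And>C. bounded_linear C \<Longrightarrow> C \<circ> A = A \<circ> C \<Longrightarrow> C \<circ> P = P \<circ> C"
proof -
  interpret A: bounded_linear A by fact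
  \<comment> \<open>The scale is at least the norm of \<open>A\<close>, so the form of
    \<open>k\<close> lies between 0 and \<open>(norm x)^2\<close>; the added 1 keeps it positive for
    \<open>A = 0\<close>.\<close>
  define c where "c = onorm A + 1"
  have "0 < c" using onorm_pos_le[OF A] by (simp add: c_def)
  define k where "k x = x - (1 / c) *\<^sub>R A x" for x
  have k: "bounded_linear k"
    unfolding k_def by (intro bounded_linear_intros A)
  define K where "K = Blinfun k"
  have K_apply: "blinfun_apply K = k" using k by (simp add: K_def bounded_linear_Blinfun_apply)
  have k_sym: "inner (k x) y = inner x (k y)" for x y
    by (simp add: k_def inner_simps sym)
  have k_le: "\<bar>inner (k x) x\<bar> \<le> (norm x)\<^sup>2" for x
  proof -
    have "inner (A x) x \<le> norm (A x) * norm x" by (rule norm_cauchy_schwarz)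
    also have "\<dots> \<le> onorm A * norm x * norm x"
      by (intro mult_right_mono onorm A norm_ge_zero)
    also have "\<dots> \<le> c * (norm x)\<^sup>2" by (simp add: c_def power2_eq_square algebra_simps)
    finally have "inner (A x) x / c \<le> (norm x)\<^sup>2" using \<open>0 < c\<close> by (simp add: field_simps)
    moreover have "0 \<le> inner (A x) x / c" using pos \<open>0 < c\<close> by simp
    moreover have "inner (k x) x = (norm x)\<^sup>2 - inner (A x) x / c"
      by (simp add: k_def inner_simps power2_norm_eq_inner)
    ultimately show ?thesis by simp
  qed
  have "norm (k x) \<le> norm x" for x
    using symmetric_norm_le[of k x] bounded_linear.linear[OF k] k_sym k_le by blast
  then have nK: "norm K \<le> 1" by (intro norm_blinfun_bound) (simp_all add: K_apply)
  obtain Y where Y: "sqrt_iter K \<longlonglongrightarrow> Y"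
    using convergent_sqrt_iter[OF nK] by (auto simp: convergent_def)
  have Yx: "(\<lambda>n. sqrt_iter K n x) \<longlonglongrightarrow> Y x" for x by (intro tendsto_intros Y)
  have "(\<lambda>n. sqrt_iter K (Suc n)) \<longlonglongrightarrow> (1/2) *\<^sub>R (K + (Y o\<^sub>L Y))"
    unfolding sqrt_iter.simps
    by (intro tendsto_intros bounded_bilinear.tendsto[OF bounded_bilinear_blinfun_compose] Y)
  with LIMSEQ_Suc[OF Y] have fixpoint: "Y = (1/2) *\<^sub>R (K + (Y o\<^sub>L Y))" by (rule LIMSEQ_unique)
  have fix_apply: "Y x = (1/2) *\<^sub>R (k x + Y (Y x))" for x
    using arg_cong[OF fixpoint, of "\<lambda>B. blinfun_apply B x"]
    by (simp add: blinfun.bilinear_simps K_apply)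
  have nY: "norm Y \<le> 1"
    by (rule LIMSEQ_le_const2[OF tendsto_norm[OF Y]])
      (use norm_sqrt_iter_le[OF nK] sqrt_iter_bound_range order_trans in blast)
  have iter_sym: "inner (sqrt_iter K n x) y = inner x (sqrt_iter K n y)" for n x y
    by (induction n arbitrary: x y) (simp_all add: blinfun.bilinear_simps inner_simps K_apply k_sym)
  have Y_sym: "inner (Y x) y = inner x (Y y)" for x y
  proof (rule LIMSEQ_unique)
    show "(\<lambda>n. inner (sqrt_iter K n x) y) \<longlonglongrightarrow> inner (Y x) y"
      by (intro tendsto_intros Yx)
    show "(\<lambda>n. inner (sqrt_iter K n x) y) \<longlonglongrightarrow> inner x (Y y)"
      unfolding iter_sym by (intro tendsto_intros Yx)
  qed
  define P where "P x = sqrt c *\<^sub>R (x - Y x)" for x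
  show ?thesis
  proof
    show "bounded_linear P"
      unfolding P_def by (intro bounded_linear_intros)
    show "inner (P x) y = inner x (P y)" for x y by (simp add: P_def inner_simps Y_sym)
    show "0 \<le> inner (P x) x" for x
    proof -
      have "inner (Y x) x \<le> norm (Y x) * norm x" by (rule norm_cauchy_schwarz)
      also have "\<dots> \<le> 1 * norm x * norm x"
        by (intro mult_right_mono order_trans[OF norm_blinfun] nY norm_ge_zero)
      finally show ?thesis
        using \<open>0 < c\<close> by (simp add: P_def inner_simps dot_square_norm power2_eq_square)
    qed
    show "P (P x) = A x" for x
    proof -
      have "P (P x) = c *\<^sub>R (x - 2 *\<^sub>R Y x + Y (Y x))"
        using \<open>0 < c\<close>
        by (simp add: P_def blinfun.bilinear_simps scaleR_2 algebra_simps)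
      also have "2 *\<^sub>R Y x = k x + Y (Y x)" by (subst fix_apply) simp
      finally show ?thesis using \<open>0 < c\<close> by (simp add: k_def algebra_simps)
    qed
    show "C \<circ> P = P \<circ> C" if C: "bounded_linear C" and "C \<circ> A = A \<circ> C" for C
    proof -
      interpret C: bounded_linear C by fact
      have comm: "C (A x) = A (C x)" for x
        using \<open>C \<circ> A = A \<circ> C\<close> by (simp add: fun_eq_iff)
      have iter_comm: "C (sqrt_iter K n x) = sqrt_iter K n (C x)" for n x
        by (induction n arbitrary: x)
          (simp_all add: blinfun.bilinear_simps K_apply k_def C.scaleR C.add C.diff C.zero comm)
      have "C (Y x) = Y (C x)" for x
        using C.tendsto[OF Yx[of x]] Yx[of "C x"] LIMSEQ_unique unfolding iter_comm by blast
      then show ?thesis by (simp add: P_def C.scaleR C.diff fun_eq_iff)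
    qed
  qed
qed

subsection \<open>Complex inner products\<close>

lemma cinner_add_right: "cinner x (y + z) = cinner x y + cinner x z"
  by (metis cinner_add_left cinner_commute complex_cnj_add)

lemma cinner_scaleC_right: "cinner x (a *\<^sub>C y) = cnj a * cinner x y"
  by (metis cinner_commute cinner_scaleC_left complex_cnj_mult)

lemma cinner_diff_left: "cinner (x - y) z = cinner x z - cinner y z"
  using cinner_add_left[of "x - y" y z] by simp

lemma cinner_diff_right: "cinner x (y - z) = cinner x y - cinner x z"
  using cinner_add_right[of x "y - z" z] by simp

lemma cinner_zero_left [simp]: "cinner 0 x = 0"
  using cinner_diff_left[of 0 0 x] by simp

lemma cinner_eqI:
  assumes "\<And>x. cinner x y = cinner x z"
  shows "y = z"
proof -
  have "cinner (y - z) (y - z) = 0" by (simp add: cinner_diff_right assms)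
  then show ?thesis by (simp add: cinner_self)
qed

text \<open>Lets identities for the real inner product be lifted to the complex form.\<close>

lemma Im_cinner: "Im (cinner x y) = - inner (\<i> *\<^sub>C x) y"
  by (simp add: inner_eq_Re_cinner cinner_scaleC_left)

lemma norm_scaleC: "norm (a *\<^sub>C x) = cmod a * norm x"
proof -
  have "complex_of_real ((norm (a *\<^sub>C x))\<^sup>2) = (a * cnj a) * complex_of_real ((norm x)\<^sup>2)"
    unfolding cinner_self[symmetric] by (simp add: cinner_scaleC_left cinner_scaleC_right)
  also have "\<dots> = complex_of_real ((cmod a * norm x)\<^sup>2)"
    by (simp add: power_mult_distrib flip: complex_norm_square)
  finally have "(norm (a *\<^sub>C x))\<^sup>2 = (cmod a * norm x)\<^sup>2"
    using of_real_eq_iff by blast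
  then show ?thesis by (simp add: power2_eq_iff_nonneg)
qed

lemma bounded_linear_scaleC: "bounded_linear (\<lambda>x. a *\<^sub>C (x :: 'a :: complex_inner))"
proof (rule bounded_linear_intro[where K = "cmod a"])
  show "a *\<^sub>C (r *\<^sub>R x) = r *\<^sub>R (a *\<^sub>C x)" for r and x :: 'a
    by (simp add: scaleR_scaleC scaleC_scaleC mult.commute)
qed (simp_all add: scaleC_add_right norm_scaleC mult.commute)

text \<open>Multiplying \<open>x\<close> by the unimodular \<open>u\<close> makes the complex
  product real and nonnegative, so the real Cauchy-Schwarz inequality applies.\<close>

lemma cmod_cinner_le: "cmod (cinner x y) \<le> norm x * norm y"
proof (cases "cinner x y = 0")
  case False
  define u where "u = cnj (cinner x y) / cmod (cinner x y)"
  have "u * cinner x y = complex_of_real (cmod (cinner x y))"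
    using False complex_norm_square[of "cinner x y"]
    by (simp add: u_def field_simps power2_eq_square)
  then have "cmod (cinner x y) = inner (u *\<^sub>C x) y"
    by (simp add: inner_eq_Re_cinner cinner_scaleC_left)
  also have "\<dots> \<le> norm (u *\<^sub>C x) * norm y" by (rule norm_cauchy_schwarz)
  finally show ?thesis using False by (simp add: norm_scaleC u_def norm_divide)
qed simp

subsection \<open>Adjoints\<close>

lemma bounded_clinear_linear: "bounded_clinear A \<Longrightarrow> bounded_linear A"
  and bounded_clinear_scaleC: "bounded_clinear A \<Longrightarrow> A (c *\<^sub>C x) = c *\<^sub>C A x"
  by (simp_all add: bounded_clinear_def)

lemma bounded_clinear_compose:
  "bounded_clinear A \<Longrightarrow> bounded_clinear B \<Longrightarrow> bounded_clinear (A \<circ> B)"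
  by (auto simp: bounded_clinear_def o_def intro: bounded_linear_compose)

lemma bounded_clinear_funpow:
  fixes A :: "'a :: complex_inner \<Rightarrow> 'a"
  assumes "bounded_clinear A"
  shows "bounded_clinear (A ^^ n)"
proof (induction n)
  case 0
  have "A ^^ 0 = (\<lambda>x. x)" by (simp add: fun_eq_iff)
  then show ?case unfolding bounded_clinear_def by (simp only: bounded_linear_ident) simp
next
  case (Suc n)
  then show ?case using assms by (simp add: bounded_clinear_compose[unfolded o_def] o_def)
qed

text \<open>Real Riesz representation yields \<open>B\<close> for the real parts; complex linearity
  of \<open>A\<close> extends the identity to \<open>cinner\<close>. Boundedness comes from
  \<open>(norm (B y))^2 = inner (A (B y)) y\<close>.\<close>

lemma adjoint_exists:
  fixes A :: "'a :: chilbert_space \<Rightarrow> 'a"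
  assumes A: "bounded_clinear A"
  shows "\<exists>B. bounded_clinear B \<and> (\<forall>x y. cinner (A x) y = cinner x (B y))"
proof -
  interpret A: bounded_linear A using A by (rule bounded_clinear_linear)
  have "\<exists>u. \<forall>x. inner (A x) y = inner u x" for y
    by (rule riesz_representation_real)
      (rule bounded_linear_compose[OF bounded_linear_inner_left A.bounded_linear])
  then obtain B where "\<And>x y. inner (A x) y = inner (B y) x" by metis
  then have B: "inner (A x) y = inner x (B y)" for x y by (simp add: inner_commute)
  have adj: "cinner (A x) y = cinner x (B y)" for x y
    by (rule complex_eqI)
      (simp_all add: Im_cinner B flip: inner_eq_Re_cinner bounded_clinear_scaleC[OF A])
  obtain K where K: "0 \<le> K" "\<And>x. norm (A x) \<le> norm x * K"
    using A.nonneg_bounded by blast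
  have "norm (B y) \<le> norm y * K" for y
  proof -
    have "norm (B y) * norm (B y) = inner (A (B y)) y" 
      by (simp add: B power2_eq_square flip: power2_norm_eq_inner)
    also have "\<dots> \<le> norm (A (B y)) * norm y" by (rule norm_cauchy_schwarz)
    also have "\<dots> \<le> norm (B y) * K * norm y" by (intro mult_right_mono K norm_ge_zero)
    finally have "norm (B y) * norm (B y) \<le> norm (B y) * (norm y * K)" by (simp add: mult_ac)
    then show ?thesis using K by (cases "B y = 0") simp_all
  qed
  moreover have scaleC: "B (c *\<^sub>C y) = c *\<^sub>C B y" for c y
    by (rule cinner_eqI) (simp add: cinner_scaleC_right flip: adj)
  moreover have "B (x + y) = B x + B y" for x y
    by (rule cinner_eqI) (simp add: cinner_add_right flip: adj)
  ultimately have "bounded_linear B"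
    by (intro bounded_linear_intro) (simp_all add: scaleR_scaleC)
  with scaleC adj show ?thesis by (auto simp: bounded_clinear_def)
qed

lemma cadjoint_eqI:
  assumes "bounded_clinear B" and "\<And>x y. cinner (A x) y = cinner x (B y)"
  shows "cadjoint A = B"
  unfolding cadjoint_def
proof (rule the_equality)
  fix B' assume "bounded_clinear B' \<and> (\<forall>x y. cinner (A x) y = cinner x (B' y))"
  then show "B' = B" using assms(2) by (intro ext cinner_eqI) metis
qed (use assms in blast)

lemma
  assumes "bounded_clinear A"
  shows bounded_clinear_cadjoint: "bounded_clinear (cadjoint A)"
    and cinner_cadjoint_right: "cinner x (cadjoint A y) = cinner (A x) y"
  using adjoint_exists[OF assms] cadjoint_eqI by metis+

lemma cinner_cadjoint_left:
  "bounded_clinear A \<Longrightarrow> cinner (cadjoint A x) y = cinner x (A y)"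
  by (metis cinner_cadjoint_right cinner_commute)

subsection \<open>Positive operators and the absolute value\<close>

text \<open>Complex polarization: reality of the form at \<open>x + y\<close> compares imaginary
  parts, and at \<open>x + \<i> *\<^sub>C y\<close> real parts.\<close>

lemma positive_op_symmetric:
  assumes "positive_op P"
  shows "cinner (P x) y = cinner x (P y)"
proof -
  have P: "bounded_clinear P" using assms by (simp add: positive_op_def)
  interpret P: bounded_linear P using P by (rule bounded_clinear_linear)
  have real: "Im (cinner (P z) z) = 0" for z
    using assms by (auto simp: positive_op_def complex_nonneg_Reals_iff)
  have "Im (cinner (P x) y + cinner (P y) x) = 0"
    using real[of "x + y"] real[of x] real[of y]
    by (simp add: P.add cinner_add_left cinner_add_right)
  moreover have "Re (cinner (P x) y) = Re (cinner (P y) x)"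
    using real[of "x + \<i> *\<^sub>C y"] real[of x] real[of y]
    by (simp add: P.add bounded_clinear_scaleC[OF P] cinner_add_left cinner_add_right
        cinner_scaleC_left cinner_scaleC_right)
  ultimately have "cinner (P x) y = cnj (cinner (P y) x)" by (simp add: complex_eq_iff)
  then show ?thesis by (metis cinner_commute)
qed

lemma positive_op_sqrt:
  assumes A: "positive_op A"
  obtains P where "positive_op P" "P \<circ> P = A"
    "\<And>C. bounded_linear C \<Longrightarrow> C \<circ> A = A \<circ> C \<Longrightarrow> C \<circ> P = P \<circ> C"
proof -
  have Acl: "bounded_clinear A" using A by (simp add: positive_op_def)
  have lin: "bounded_linear A" using Acl by (rule bounded_clinear_linear)
  have sym: "inner (A x) y = inner x (A y)" for x y
    by (simp add: inner_eq_Re_cinner positive_op_symmetric[OF A])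
  have pos: "0 \<le> inner (A x) x" for x
    using A by (simp add: inner_eq_Re_cinner positive_op_def complex_nonneg_Reals_iff)
  show thesis
  proof (rule symmetric_positive_sqrt[OF lin sym pos])
    fix P
    assume P: "bounded_linear P" "\<And>x y. inner (P x) y = inner x (P y)"
      "\<And>x. 0 \<le> inner (P x) x" "\<And>x. P (P x) = A x"
      "\<And>C. bounded_linear C \<Longrightarrow> C \<circ> A = A \<circ> C \<Longrightarrow> C \<circ> P = P \<circ> C"
    \<comment> \<open>Multiplication by \<open>c\<close> is real linear and commutes with
      \<open>A\<close>, so it commutes with the real square root.\<close>
    have scaleC: "P (c *\<^sub>C x) = c *\<^sub>C P x" for c x
      using P(5)[OF bounded_linear_scaleC, of c] bounded_clinear_scaleC[OF Acl]
      by (simp add: fun_eq_iff)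
    have "Im (cinner (P x) x) = 0" for x
    proof -
      have "inner (\<i> *\<^sub>C P x) x = inner (\<i> *\<^sub>C x) (P x)"
        using P(2)[of "\<i> *\<^sub>C x" x] by (simp add: scaleC)
      moreover have "Im (cinner x (P x)) = - Im (cinner (P x) x)"
        by (metis cinner_commute cnj.simps(2))
      ultimately show ?thesis by (simp add: Im_cinner)
    qed
    then have "positive_op P"
      using P(1,3) scaleC
      by (auto simp: positive_op_def bounded_clinear_def complex_nonneg_Reals_iff inner_eq_Re_cinner)
    then show thesis
      by (rule that) (use P(4,5) in \<open>auto simp: fun_eq_iff\<close>)
  qed
qed

text \<open>For a square root \<open>R\<close> of \<open>P\<close>, the form at \<open>x\<close> is
  \<open>(norm (R x))^2\<close>.\<close>

lemma positive_op_eq_0: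
  assumes P: "positive_op P" and "cinner (P x) x = 0"
  shows "P x = 0"
proof -
  obtain R where R: "positive_op R" "R \<circ> R = P" using positive_op_sqrt[OF P] by metis
  have Rcl: "bounded_linear R" using R(1) by (simp add: positive_op_def bounded_clinear_def)
  have "cinner (R x) (R x) = cinner (P x) x"
    by (simp add: positive_op_symmetric[OF R(1)] flip: R(2))
  then have "R x = 0" using assms(2) by (simp add: cinner_self)
  then show ?thesis using R(2) by (auto simp: linear_simps(3)[OF Rcl])
qed

text \<open>\<open>Q\<close> commutes with its own square \<open>A\<close>, hence with
  \<open>P\<close>. So \<open>P + Q\<close> kills \<open>y = P x - Q x\<close>; both nonnegative
  forms vanish at \<open>y\<close>, whence \<open>P y = Q y = 0\<close>, and symmetry gives
  \<open>cinner y y = 0\<close>.\<close>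

lemma positive_op_sqrt_unique:
  assumes A: "positive_op A"
    and P: "positive_op P" "P \<circ> P = A"
    and comm: "\<And>C. bounded_linear C \<Longrightarrow> C \<circ> A = A \<circ> C \<Longrightarrow> C \<circ> P = P \<circ> C"
    and Q: "positive_op Q" "Q \<circ> Q = A"
  shows "Q = P"
proof
  fix x
  interpret P: bounded_linear P using P(1) by (simp add: positive_op_def bounded_clinear_def)
  interpret Q: bounded_linear Q using Q(1) by (simp add: positive_op_def bounded_clinear_def)
  have PP: "P (P z) = A z" and QQ: "Q (Q z) = A z" for z
    using P(2) Q(2) by (auto simp: fun_eq_iff)
  have QP: "Q (P z) = P (Q z)" for z
  proof -
    have "Q \<circ> A = A \<circ> Q" unfolding Q(2)[symmetric] by (simp add: o_assoc)
    then show ?thesis using comm[OF Q.bounded_linear] by (simp add: fun_eq_iff)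
  qed
  define y where "y = P x - Q x"
  have "P y + Q y = 0" by (simp add: y_def P.diff Q.diff PP QQ QP)
  then have "cinner (P y) y + cinner (Q y) y = 0" by (simp flip: cinner_add_left)
  moreover have "cinner (P y) y \<in> \<real>\<^sub>\<ge>\<^sub>0" "cinner (Q y) y \<in> \<real>\<^sub>\<ge>\<^sub>0"
    using P(1) Q(1) by (simp_all add: positive_op_def)
  ultimately have "cinner (P y) y = 0" "cinner (Q y) y = 0"
    by (auto simp: complex_nonneg_Reals_iff complex_eq_iff)
  then have "P y = 0" "Q y = 0"
    using positive_op_eq_0 P(1) Q(1) by blast+
  then have "cinner y y = 0"
    by (subst (1) y_def)
      (simp add: cinner_diff_left positive_op_symmetric[OF P(1)] positive_op_symmetric[OF Q(1)])
  then show "Q x = P x" by (simp add: cinner_self y_def)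
qed

lemma op_sqrt:
  assumes A: "positive_op A"
  shows "positive_op (op_sqrt A) \<and> op_sqrt A \<circ> op_sqrt A = A"
proof -
  obtain P where P: "positive_op P" "P \<circ> P = A"
    "\<And>C. bounded_linear C \<Longrightarrow> C \<circ> A = A \<circ> C \<Longrightarrow> C \<circ> P = P \<circ> C"
    using positive_op_sqrt[OF A] by blast
  have "\<exists>!P. positive_op P \<and> P \<circ> P = A"
    using P positive_op_sqrt_unique[OF A P] by blast
  then show ?thesis unfolding op_sqrt_def by (rule theI')
qed

lemma
  assumes T: "bounded_clinear T"
  shows positive_op_abs: "positive_op (op_abs T)"
    and norm_op_abs: "norm (op_abs T x) = norm (T x)"
proof -
  have "positive_op (cadjoint T \<circ> T)"
    using T
    by (simp add: positive_op_def bounded_clinear_compose bounded_clinear_cadjoint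
        cinner_cadjoint_left cinner_self complex_nonneg_Reals_iff)
  note R = op_sqrt[OF this, folded op_abs_def]
  then show pos: "positive_op (op_abs T)" by simp
  have "op_abs T (op_abs T x) = cadjoint T (T x)"
    using R by (simp add: fun_eq_iff)
  then have "cinner (op_abs T x) (op_abs T x) = cinner (T x) (T x)"
    by (simp add: positive_op_symmetric[OF pos] cinner_cadjoint_right[OF T])
  then have "(norm (op_abs T x))\<^sup>2 = (norm (T x))\<^sup>2"
    unfolding cinner_self of_real_eq_iff .
  then show "norm (op_abs T x) = norm (T x)" by simp
qed

subsection \<open>Vector inequalities\<close>

text \<open>The vector \<open>v\<close> has the component of \<open>a\<close> along \<open>e\<close>
  multiplied by \<open>\<alpha> - 1\<close> and the orthogonal component multiplied by
  \<open>-1\<close>, so its norm is at most \<open>max 1 (cmod (\<alpha> - 1))\<close> times that of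
  \<open>a\<close>. The case \<open>\<alpha> = 2\<close> is Buzano's inequality.\<close>

lemma Buzano_generalized:
  fixes a b e :: "'a :: complex_inner"
  assumes "norm e = 1"
  shows "cmod \<alpha> * (cmod (cinner a e) * cmod (cinner e b))
    \<le> max 1 (cmod (\<alpha> - 1)) * (norm a * norm b) + cmod (cinner a b)"
proof -
  define p where "p = cinner a e"
  define v where "v = (\<alpha> * p) *\<^sub>C e - a"
  have ee: "cinner e e = 1" using assms by (simp add: cinner_self)
  have ea: "cinner e a = cnj p" unfolding p_def by (metis cinner_commute)
  have "cinner v v = \<alpha> * p * cnj (\<alpha> * p) - \<alpha> * p * cnj p - cnj (\<alpha> * p) * p + cinner a a"
    unfolding v_def
    by (simp add: cinner_diff_left cinner_diff_right cinner_scaleC_left cinner_scaleC_right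
        ee ea algebra_simps flip: p_def)
  also have "\<dots> = ((\<alpha> - 1) * cnj (\<alpha> - 1)) * (p * cnj p) - p * cnj p + cinner a a"
    by (simp add: algebra_simps)
  also have "\<dots> = complex_of_real
      ((cmod (\<alpha> - 1))\<^sup>2 * (cmod p)\<^sup>2 - (cmod p)\<^sup>2 + (norm a)\<^sup>2)"
    unfolding complex_norm_square[symmetric] cinner_self by simp
  finally have nv: "(norm v)\<^sup>2 = (cmod (\<alpha> - 1))\<^sup>2 * (cmod p)\<^sup>2 + ((norm a)\<^sup>2 - (cmod p)\<^sup>2)"
    unfolding cinner_self of_real_eq_iff by simp
  define M where "M = max 1 (cmod (\<alpha> - 1))"
  have M: "1 \<le> M" "cmod (\<alpha> - 1) \<le> M" by (simp_all add: M_def)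
  have "cmod p \<le> norm a" using cmod_cinner_le[of a e] assms by (simp add: p_def)
  then have "(cmod p)\<^sup>2 \<le> (norm a)\<^sup>2" by (simp add: power_mono)
  then have "(norm v)\<^sup>2 \<le> M\<^sup>2 * (cmod p)\<^sup>2 + M\<^sup>2 * ((norm a)\<^sup>2 - (cmod p)\<^sup>2)"
    unfolding nv using M mult_right_mono[of 1 "M\<^sup>2" "(norm a)\<^sup>2 - (cmod p)\<^sup>2"]
    by (intro add_mono mult_right_mono power_mono) (simp_all add: one_le_power)
  also have "\<dots> = (M * norm a)\<^sup>2" by (simp add: algebra_simps)
  finally have "norm v \<le> M * norm a" using M by (auto intro: power2_le_imp_le)
  have "cmod \<alpha> * (cmod p * cmod (cinner e b)) = cmod (cinner v b + cinner a b)"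
    by (simp add: v_def cinner_diff_left cinner_scaleC_left norm_mult)
  also have "\<dots> \<le> norm v * norm b + cmod (cinner a b)"
    by (rule norm_triangle_le) (simp add: cmod_cinner_le)
  also have "\<dots> \<le> M * norm a * norm b + cmod (cinner a b)"
    using \<open>norm v \<le> M * norm a\<close> by (simp add: mult_right_mono)
  finally show ?thesis by (simp add: p_def M_def mult.assoc)
qed

text \<open>The combination \<open>u\<close> is chosen so that \<open>cinner u e\<close> is the sum
  of squares \<open>s\<close>. Cauchy-Schwarz gives \<open>s^2 \<le> (norm u)^2\<close>, and the
  right side is a value of the quadratic form of the Gram matrix of \<open>a\<close> and
  \<open>b\<close>.\<close>

lemma sum_square_cinner_le:
  fixes a b e :: "'a :: complex_inner"
  assumes "norm e = 1"
  shows "((cmod (cinner a e))\<^sup>2 + (cmod (cinner e b))\<^sup>2)\<^sup>2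
    \<le> norm a ^ 4 + norm b ^ 4 + 2 * (cmod (cinner a b))\<^sup>2"
proof -
  define p q c where "p = cinner a e" and "q = cinner b e" and "c = cinner a b"
  have ea: "cinner e a = cnj p" and eb: "cinner e b = cnj q" and ba: "cinner b a = cnj c"
    unfolding p_def q_def c_def by (metis cinner_commute)+
  define u where "u = cnj p *\<^sub>C a + cnj q *\<^sub>C b"
  define s where "s = (cmod p)\<^sup>2 + (cmod q)\<^sup>2"
  define F where "F = norm a ^ 4 + norm b ^ 4 + 2 * (cmod c)\<^sup>2"
  define E where "E = (cmod p)\<^sup>2 * (norm a)\<^sup>2 + (cmod q)\<^sup>2 * (norm b)\<^sup>2
    + 2 * (cmod p * cmod q * cmod c)"
  have "cinner u e = cnj p * p + cnj q * q"
    by (simp add: u_def cinner_add_left cinner_scaleC_left flip: p_def q_def)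
  also have "\<dots> = complex_of_real s"
    by (simp add: s_def complex_norm_square mult.commute del: of_real_power)
  finally have "cmod (cinner u e) = s" by (simp add: s_def del: of_real_power of_real_add)
  then have "s \<le> norm u" using cmod_cinner_le[of u e] assms by simp
  then have "s\<^sup>2 \<le> (norm u)\<^sup>2" by (simp add: s_def power_mono)
  also have "(norm u)\<^sup>2 = Re (cinner u u)" by (simp add: cinner_self)
  also have "\<dots> = (cmod p)\<^sup>2 * (norm a)\<^sup>2 + (cmod q)\<^sup>2 * (norm b)\<^sup>2 + 2 * Re (cnj p * q * c)"
    unfolding u_def
    by (simp add: cinner_add_left cinner_add_right cinner_scaleC_left cinner_scaleC_right
        ba cinner_self[of a] cinner_self[of b] power2_eq_square algebra_simps
        cmod_power2[of p, unfolded power2_eq_square] cmod_power2[of q, unfolded power2_eq_square]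
        flip: c_def)
  also have "\<dots> \<le> (cmod p)\<^sup>2 * (norm a)\<^sup>2 + (cmod q)\<^sup>2 * (norm b)\<^sup>2 + 2 * (cmod p * cmod q * cmod c)"
    using complex_Re_le_cmod[of "cnj p * q * c"] by (simp add: norm_mult)
  finally have "s\<^sup>2 \<le> E" by (simp add: E_def)
  \<comment> \<open>Entrywise \<open>2 x y \<le> x^2 + y^2\<close>: \<open>F\<close> is the squared
    Frobenius norm of the Gram matrix and \<open>s^2\<close> that of the matrix of products of
    \<open>cmod p\<close> and \<open>cmod q\<close>.\<close>
  moreover have "2 * E \<le> s\<^sup>2 + F"
  proof -
    have "0 \<le> ((cmod p)\<^sup>2 - (norm a)\<^sup>2)\<^sup>2 + ((cmod q)\<^sup>2 - (norm b)\<^sup>2)\<^sup>2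
        + 2 * (cmod p * cmod q - cmod c)\<^sup>2"
      by simp
    then show ?thesis
      unfolding s_def F_def E_def by (simp add: power4_eq_xxxx power2_eq_square algebra_simps)
  qed
  ultimately have "s\<^sup>2 \<le> F" by linarith
  moreover have "cmod (cinner e b) = cmod q" by (simp add: eb)
  ultimately show ?thesis by (simp add: s_def F_def p_def c_def)
qed

section \<open>Scalar inequalities for the fourth power of a sum\<close>

lemma fourth_power_sum_le:
  fixes p q :: real
  shows "(p + q) ^ 4 \<le> 2 * (p\<^sup>2 + q\<^sup>2)\<^sup>2 + 8 * (p * q)\<^sup>2"
proof -
  \<comment> \<open>This is exactly the difference of the two sides.\<close>
  have "0 \<le> ((p - q)\<^sup>2)\<^sup>2" by simp
  then show ?thesis by (simp add: power4_eq_xxxx power2_eq_square algebra_simps)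
qed

text \<open>The scalar core of the theorem: \<open>r\<close> and \<open>m\<close> stand for
  \<open>cmod \<alpha>\<close> and \<open>max 1 (cmod (\<alpha> - 1))\<close>, \<open>a\<close> and
  \<open>b\<close> for norms, \<open>c\<close> for \<open>cmod (cinner a b)\<close>, and
  \<open>w\<close> for the numerical radius of the off-diagonal matrix.\<close>

lemma fourth_power_sum_weighted_le:
  fixes p q c a b w m r \<beta> \<mu> N2 N4 \<chi>1 \<chi>2 \<chi>3 \<chi>4 :: real
  assumes nonneg: "0 \<le> p" "0 \<le> q" "0 \<le> c" "0 \<le> a" "0 \<le> b" "0 \<le> m" "0 < r" "0 \<le> \<beta>"
    and \<mu>: "0 \<le> \<mu>" "\<mu> \<le> 1"
    and pq: "r * (p * q) \<le> m * (a * b) + c"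
    and gram: "(p\<^sup>2 + q\<^sup>2)\<^sup>2 \<le> a ^ 4 + b ^ 4 + 2 * c\<^sup>2"
    and c: "c \<le> a * b" "c \<le> w"
    and N2: "a\<^sup>2 + b\<^sup>2 \<le> N2" and N4: "a ^ 4 + b ^ 4 \<le> N4"
    and \<chi>1: "\<chi>1 = (\<beta> + (\<beta> + 1) * m\<^sup>2) / (r\<^sup>2 * (\<beta> + 1))"
    and \<chi>2: "\<chi>2 = (1 + 2 * (\<beta> + 1) * m) / (r\<^sup>2 * (\<beta> + 1))"
    and \<chi>3: "\<chi>3 = (2 * \<beta> + 2 * (\<beta> + 1) * m\<^sup>2) / (r\<^sup>2 * (\<beta> + 1))"
    and \<chi>4: "\<chi>4 = 2 / (r\<^sup>2 * (\<beta> + 1))"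
  shows "(p + q) ^ 4 \<le> (2 + 2 * \<chi>1 + 2 * \<chi>3) * N4 + (2 * \<chi>2 + 2 * \<mu> * \<chi>4) * N2 * w
    + (4 + 4 * (1 - \<mu>) * \<chi>4) * w\<^sup>2"
proof -
  define n where "n = a * b"
  have "0 \<le> n" using nonneg by (simp add: n_def)
  have "0 \<le> (a - b)\<^sup>2" "0 \<le> (a\<^sup>2 - b\<^sup>2)\<^sup>2" by simp_all
  then have n_le: "2 * n \<le> N2" and n2_le: "2 * n\<^sup>2 \<le> N4"
    using N2 N4 unfolding n_def by (simp_all add: power4_eq_xxxx power2_eq_square algebra_simps)
  have "c * c \<le> n * c" using c(1) nonneg(3) unfolding n_def by (rule mult_right_mono)
  then have cc: "c\<^sup>2 \<le> n * c" by (simp add: power2_eq_square)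
  have "n * c \<le> n * n" using c(1) \<open>0 \<le> n\<close> unfolding n_def by (rule mult_left_mono)
  then have nc: "n * c \<le> n\<^sup>2" by (simp add: power2_eq_square)
  define s t where "s = \<beta> / (\<beta> + 1)" and "t = 1 / (\<beta> + 1)"
  have st: "0 \<le> s" "0 \<le> t" "s + t = 1"
    using nonneg(8) by (simp_all add: s_def t_def flip: add_divide_distrib)
  have X1: "\<chi>1 = (s + m\<^sup>2) / r\<^sup>2" and X2: "\<chi>2 = (t + 2 * m) / r\<^sup>2"
    and X3: "\<chi>3 = 2 * (s + m\<^sup>2) / r\<^sup>2" and X4: "\<chi>4 = 2 * t / r\<^sup>2"
    unfolding \<chi>1 \<chi>2 \<chi>3 \<chi>4 s_def t_def using nonneg(7,8) by (simp_all add: field_simps)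
  have X_nonneg: "0 \<le> \<chi>1" "0 \<le> \<chi>2" "0 \<le> \<chi>3" "0 \<le> \<chi>4"
    unfolding X1 X2 X3 X4 using st nonneg by simp_all
  have "(r * (p * q))\<^sup>2 \<le> (m * n + c)\<^sup>2"
    using pq nonneg unfolding n_def by (intro power_mono) simp_all
  then have sq: "r\<^sup>2 * (p * q)\<^sup>2 \<le> (m * n + c)\<^sup>2" by (simp only: power_mult_distrib)
  have c2_split: "c\<^sup>2 = s * c\<^sup>2 + t * c\<^sup>2"
    using st(3) by (metis distrib_right mult_1)
  have sc: "s * c\<^sup>2 \<le> s * n\<^sup>2" using cc nc st by (intro mult_left_mono) simp_all
  have tc: "t * c\<^sup>2 \<le> t * (n * c)" using cc st by (intro mult_left_mono)
  \<comment> \<open>First bound: the cross term is kept and joins the \<open>n * c\<close> part of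
    \<open>c^2\<close>, which produces \<open>\<chi>2\<close>.\<close>
  have "(m * n + c)\<^sup>2 = m\<^sup>2 * n\<^sup>2 + 2 * m * (n * c) + c\<^sup>2"
    by (simp add: power2_eq_square algebra_simps)
  also have "\<dots> \<le> (s + m\<^sup>2) * n\<^sup>2 + (t + 2 * m) * (n * c)"
    using c2_split sc tc by (simp only: distrib_right)
  finally have "(p * q)\<^sup>2 \<le> ((s + m\<^sup>2) * n\<^sup>2 + (t + 2 * m) * (n * c)) / r\<^sup>2"
    using sq nonneg(7) by (simp add: pos_le_divide_eq mult.commute)
  then have h1: "(p * q)\<^sup>2 \<le> \<chi>1 * n\<^sup>2 + \<chi>2 * (n * c)"
    unfolding X1 X2 times_divide_eq_left add_divide_distrib[symmetric] .
  \<comment> \<open>Second bound: the cross term is absorbed by doubling the squares, and the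
    \<open>t\<close>-part of \<open>c^2\<close> is then divided by \<open>\<mu>\<close> between
    \<open>n * c\<close> and \<open>c^2\<close>.\<close>
  have "0 \<le> (m * n - c)\<^sup>2" by simp
  then have "(m * n + c)\<^sup>2 \<le> 2 * (m\<^sup>2 * n\<^sup>2) + 2 * c\<^sup>2"
    by (simp add: power2_eq_square algebra_simps)
  also have "\<dots> \<le> 2 * (s + m\<^sup>2) * n\<^sup>2 + 2 * t * c\<^sup>2"
    using c2_split sc by (simp add: distrib_right distrib_left)
  also have "\<dots> \<le> 2 * (s + m\<^sup>2) * n\<^sup>2 + 2 * t * (\<mu> * (n * c) + (1 - \<mu>) * c\<^sup>2)"
  proof -
    have "\<mu> * c\<^sup>2 \<le> \<mu> * (n * c)" using cc \<mu> by (intro mult_left_mono)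
    then have "c\<^sup>2 \<le> \<mu> * (n * c) + (1 - \<mu>) * c\<^sup>2" by (simp add: algebra_simps)
    then show ?thesis using st by (intro add_left_mono mult_left_mono) simp_all
  qed
  finally have "(p * q)\<^sup>2 \<le> (2 * (s + m\<^sup>2) * n\<^sup>2 + 2 * t * (\<mu> * (n * c) + (1 - \<mu>) * c\<^sup>2)) / r\<^sup>2"
    using sq nonneg(7) by (simp add: pos_le_divide_eq mult.commute)
  then have h2: "(p * q)\<^sup>2 \<le> \<chi>3 * n\<^sup>2 + \<chi>4 * (\<mu> * (n * c) + (1 - \<mu>) * c\<^sup>2)"
    unfolding X3 X4 times_divide_eq_left add_divide_distrib[symmetric] .
  have nw: "2 * (n * c) \<le> N2 * w"
    using mult_mono[OF n_le c(2)] n_le \<open>0 \<le> n\<close> nonneg(3) by simp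
  have cw: "c\<^sup>2 \<le> w\<^sup>2" using c(2) nonneg(3) by (simp add: power_mono)
  \<comment> \<open>The term \<open>8 * (p * q)^2\<close> is four times each of \<open>h1\<close>
    and \<open>h2\<close>; half of each factor 4 is spent on \<open>2 * n^2 \<le> N4\<close> and
    \<open>2 * (n * c) \<le> N2 * w\<close>.\<close>
  have "\<chi>1 * (2 * n\<^sup>2) \<le> \<chi>1 * N4" "\<chi>3 * (2 * n\<^sup>2) \<le> \<chi>3 * N4"
    "\<chi>2 * (2 * (n * c)) \<le> \<chi>2 * (N2 * w)"
    "(\<mu> * \<chi>4) * (2 * (n * c)) \<le> (\<mu> * \<chi>4) * (N2 * w)"
    "((1 - \<mu>) * \<chi>4) * c\<^sup>2 \<le> ((1 - \<mu>) * \<chi>4) * w\<^sup>2"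
    using X_nonneg n2_le nw cw \<mu> by (auto intro!: mult_left_mono)
  then show ?thesis
    using fourth_power_sum_le[of p q] gram N4 cw h1 h2 by (simp add: algebra_simps)
qed

subsection \<open>Numerical radius\<close>

lemma
  fixes A :: "'a :: chilbert_space \<Rightarrow> 'a"
  assumes A: "bounded_linear A"
  shows cinner_le_numerical_radius: "norm x = 1 \<Longrightarrow> cmod (cinner (A x) x) \<le> numerical_radius A"
    and numerical_radius_nonneg: "0 \<le> numerical_radius A"
proof -
  have "cmod (cinner (A y) y) \<le> onorm A" if "norm y = 1" for y
    using cmod_cinner_le[of "A y" y] onorm[OF A, of y] that by simp
  then have bdd: "bdd_above ((\<lambda>y. cmod (cinner (A y) y)) ` {y. norm y = 1})"
    by (auto intro!: bdd_aboveI2)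
  show le: "cmod (cinner (A x) x) \<le> numerical_radius A" if "norm x = 1" for x
    using that by (auto simp: numerical_radius_def intro!: cSUP_upper bdd)
  show "0 \<le> numerical_radius A"
  proof (cases "\<exists>x :: 'a. norm x = 1")
    case True
    then show ?thesis using le norm_ge_zero order_trans by blast
  qed (simp add: numerical_radius_def)
qed

text \<open>Nonnegativity of \<open>B\<close> covers the zero space, where the radius is 0 by
  convention.\<close>

lemma numerical_radius_le:
  fixes A :: "'a :: chilbert_space \<Rightarrow> 'a"
  assumes "\<And>x. norm x = 1 \<Longrightarrow> cmod (cinner (A x) x) \<le> B" and "0 \<le> B"
  shows "numerical_radius A \<le> B"
  using assms by (auto simp: numerical_radius_def intro!: cSUP_least)

subsection \<open>Operator matrices\<close>

lemma op_matrix_apply [simp]: "op_matrix A B C D (x, y) = (A x + B y, C x + D y)"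
  by (simp add: op_matrix_def)

lemma bounded_linear_op_matrix:
  assumes "bounded_linear A" "bounded_linear B" "bounded_linear C" "bounded_linear D"
  shows "bounded_linear (op_matrix A B C D)"
proof -
  have "op_matrix A B C D = (\<lambda>z. (A (fst z) + B (snd z), C (fst z) + D (snd z)))"
    by (simp add: fun_eq_iff)
  moreover have "bounded_linear \<dots>"
    by (intro bounded_linear_Pair bounded_linear_add
        bounded_linear_compose[OF _ bounded_linear_fst]
        bounded_linear_compose[OF _ bounded_linear_snd] assms)
  ultimately show ?thesis by simp
qed

section \<open>Norm estimates through powers of absolute values\<close>

lemma positive_op_funpow2:
  assumes "positive_op P"
  shows "positive_op (P ^^ 2)"
  using assms
  by (auto simp: positive_op_def numeral_2_eq_2 bounded_clinear_compose positive_op_symmetric[OF assms]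
      cinner_self complex_nonneg_Reals_iff)

lemma bounded_linear_sum_positive:
  assumes "positive_op P" "positive_op Q"
  shows "bounded_linear (\<lambda>x. (P ^^ n) x + (Q ^^ n) x)"
  using assms
  by (intro bounded_linear_add) (simp_all add: positive_op_def bounded_clinear_funpow bounded_clinear_linear)

lemma norm_power2_positive_op:
  assumes "positive_op P"
  shows "(norm (P x))\<^sup>2 = inner ((P ^^ 2) x) x"
proof -
  have "(P ^^ 2) x = P (P x)" by (simp add: numeral_2_eq_2)
  then show ?thesis
    by (simp add: inner_eq_Re_cinner positive_op_symmetric[OF assms] cinner_self)
qed

text \<open>The left side is the quadratic form of the sum of the squares of \<open>P\<close> and
  \<open>Q\<close>. It is used with absolute values and again with their squares.\<close>

lemma norm_sum_positive_le:
  assumes P: "positive_op P" and Q: "positive_op Q"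
  shows "(norm (P x))\<^sup>2 + (norm (Q x))\<^sup>2
    \<le> onorm (\<lambda>x. (P ^^ 2) x + (Q ^^ 2) x) * (norm x)\<^sup>2"
proof -
  let ?A = "\<lambda>x. (P ^^ 2) x + (Q ^^ 2) x"
  have "(norm (P x))\<^sup>2 + (norm (Q x))\<^sup>2 = inner (?A x) x"
    by (simp add: norm_power2_positive_op P Q inner_add_left)
  also have "\<dots> \<le> norm (?A x) * norm x" by (rule norm_cauchy_schwarz)
  also have "\<dots> \<le> onorm ?A * norm x * norm x"
    by (intro mult_right_mono onorm bounded_linear_sum_positive P Q norm_ge_zero)
  finally show ?thesis by (simp add: power2_eq_square mult.assoc)
qed

lemma norm_power2_le_op_abs:
  assumes "bounded_clinear T"
  shows "(norm (T x))\<^sup>2 \<le> norm ((op_abs T ^^ 2) x) * norm x"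
  using norm_power2_positive_op[OF positive_op_abs[OF assms], of x] norm_cauchy_schwarz
  by (simp add: norm_op_abs[OF assms])

lemma norm_sum_op_abs_le:
  assumes "bounded_clinear T" "bounded_clinear W"
  shows "(norm (T x))\<^sup>2 + (norm (W x))\<^sup>2
    \<le> onorm (\<lambda>x. (op_abs T ^^ 2) x + (op_abs W ^^ 2) x) * (norm x)\<^sup>2"
  using norm_sum_positive_le[OF positive_op_abs[OF assms(1)] positive_op_abs[OF assms(2)], of x]
  by (simp add: norm_op_abs assms)

lemma norm_sum_op_abs2_le:
  assumes "bounded_clinear T" "bounded_clinear W"
  shows "(norm ((op_abs T ^^ 2) x))\<^sup>2 + (norm ((op_abs W ^^ 2) x))\<^sup>2
    \<le> onorm (\<lambda>x. (op_abs T ^^ 4) x + (op_abs W ^^ 4) x) * (norm x)\<^sup>2"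
  using norm_sum_positive_le[of "op_abs T ^^ 2" "op_abs W ^^ 2" x]
  by (simp add: positive_op_funpow2 positive_op_abs assms funpow_mult)

text \<open>Planar Cauchy-Schwarz inequality, read off from the Lagrange identity.\<close>

lemma power2_sum_mult_le:
  fixes u v x y :: real
  assumes "x\<^sup>2 + y\<^sup>2 = 1"
  shows "(u * x + v * y)\<^sup>2 \<le> u\<^sup>2 + v\<^sup>2"
proof -
  have "(u * x + v * y)\<^sup>2 + (u * y - v * x)\<^sup>2 = (u\<^sup>2 + v\<^sup>2) * (x\<^sup>2 + y\<^sup>2)"
    by (simp add: power2_eq_square algebra_simps)
  then show ?thesis
    unfolding assms by (metis le_add_same_cancel1 mult.right_neutral zero_le_power2)
qed

theorem theorem3p25:
  fixes T S X Y :: "'a :: chilbert_space \<Rightarrow> 'a"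
    and \<mu> \<beta> \<chi>1 \<chi>2 \<chi>3 \<chi>4 :: real
    and \<alpha> :: complex
  assumes "bounded_clinear T" and "bounded_clinear S"
    and "bounded_clinear X" and "bounded_clinear Y"
    and "0 \<le> \<mu>" and "\<mu> \<le> 1"
    and "\<alpha> \<noteq> 0"
    and "0 \<le> \<beta>"
    and "\<chi>1 = (\<beta> + (\<beta> + 1) * max 1 ((cmod (\<alpha> - 1))\<^sup>2)) / ((cmod \<alpha>)\<^sup>2 * (\<beta> + 1))"
    and "\<chi>2 = (1 + 2 * (\<beta> + 1) * max 1 (cmod (\<alpha> - 1))) / ((cmod \<alpha>)\<^sup>2 * (\<beta> + 1))"
    and "\<chi>3 = (2 * \<beta> + 2 * (\<beta> + 1) * max 1 ((cmod (\<alpha> - 1))\<^sup>2)) / ((cmod \<alpha>)\<^sup>2 * (\<beta> + 1))"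
    and "\<chi>4 = 2 / ((cmod \<alpha>)\<^sup>2 * (\<beta> + 1))"
  shows "(numerical_radius (op_matrix T X Y S)) ^ 4 \<le>
      (2 + 2 * \<chi>1 + 2 * \<chi>3) *
        max (onorm (\<lambda>x. (op_abs T ^^ 4) x + (op_abs (cadjoint X) ^^ 4) x))
            (onorm (\<lambda>x. (op_abs S ^^ 4) x + (op_abs (cadjoint Y) ^^ 4) x))
      + (2 * \<chi>2 + 2 * \<mu> * \<chi>4) *
        max (onorm (\<lambda>x. (op_abs T ^^ 2) x + (op_abs (cadjoint X) ^^ 2) x))
            (onorm (\<lambda>x. (op_abs S ^^ 2) x + (op_abs (cadjoint Y) ^^ 2) x)) *
        numerical_radius (op_matrix (\<lambda>_. 0) (X \<circ> S) (Y \<circ> T) (\<lambda>_. 0))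
      + (4 + 4 * (1 - \<mu>) * \<chi>4) *
        (numerical_radius (op_matrix (\<lambda>_. 0) (X \<circ> S) (Y \<circ> T) (\<lambda>_. 0)))\<^sup>2"
    (is "?wM ^ 4 \<le> (_ + _ + _) * max ?Tf ?Sf + _ * max ?Tt ?St * ?w + _")
proof -
  note [simp] = \<open>bounded_clinear T\<close> \<open>bounded_clinear S\<close> \<open>bounded_clinear X\<close> \<open>bounded_clinear Y\<close>
    bounded_clinear_cadjoint bounded_clinear_linear
  define N2 N4 m where "N2 = max ?Tt ?St" and "N4 = max ?Tf ?Sf" and "m = max 1 (cmod (\<alpha> - 1))"
  define R where "R = (2 + 2 * \<chi>1 + 2 * \<chi>3) * N4 + (2 * \<chi>2 + 2 * \<mu> * \<chi>4) * N2 * ?w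
    + (4 + 4 * (1 - \<mu>) * \<chi>4) * ?w\<^sup>2"
  have m: "1 \<le> m" by (simp add: m_def)
  have m2: "max 1 ((cmod (\<alpha> - 1))\<^sup>2) = m\<^sup>2"
    unfolding m_def
    using one_le_power[of "cmod (\<alpha> - 1)" 2] power_le_one[of "cmod (\<alpha> - 1)" 2]
    by (cases "1 \<le> cmod (\<alpha> - 1)") auto
  have OD: "bounded_linear (op_matrix (\<lambda>_. 0) (X \<circ> S) (Y \<circ> T) (\<lambda>_. 0))"
    by (intro bounded_linear_op_matrix) (simp_all add: bounded_clinear_compose)
  have w: "0 \<le> ?w" by (rule numerical_radius_nonneg[OF OD])
  have "0 \<le> ?Tt" "0 \<le> ?Tf"
    by (simp_all add: onorm_pos_le bounded_linear_sum_positive positive_op_abs)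
  then have N: "0 \<le> N2" "0 \<le> N4" by (auto simp: N2_def N4_def)
  \<comment> \<open>Needed to recover \<open>R\<close> from its fourth root at the end.\<close>
  have "0 \<le> R"
    unfolding R_def assms m2
    using N w m assms(5-8)
    by (intro add_nonneg_nonneg mult_nonneg_nonneg divide_nonneg_nonneg) (simp_all add: m_def)
  have main: "cmod (cinner (op_matrix T X Y S z) z) ^ 4 \<le> R" if "norm z = 1" for z
  proof -
    obtain x y where z: "z = (x, y)" by fastforce
    have xy: "(norm x)\<^sup>2 + (norm y)\<^sup>2 = 1" using that by (simp add: z norm_Pair)
    define a b where "a = (T x, S y)" and "b = (cadjoint Y y, cadjoint X x)"
    have na: "(norm a)\<^sup>2 = (norm (T x))\<^sup>2 + (norm (S y))\<^sup>2"
      and nb: "(norm b)\<^sup>2 = (norm (cadjoint Y y))\<^sup>2 + (norm (cadjoint X x))\<^sup>2"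
      by (simp_all add: a_def b_def norm_Pair)
    define p q c where "p = cmod (cinner a z)" and "q = cmod (cinner z b)" and "c = cmod (cinner a b)"
    have "cinner (op_matrix T X Y S z) z = cinner a z + cinner z b"
      by (simp add: z a_def b_def cinner_prod_def cinner_add_left cinner_cadjoint_right)
    then have "cmod (cinner (op_matrix T X Y S z) z) \<le> p + q"
      by (simp add: p_def q_def norm_triangle_ineq)
    then have "cmod (cinner (op_matrix T X Y S z) z) ^ 4 \<le> (p + q) ^ 4"
      by (simp add: power_mono)
    also have "\<dots> \<le> R" unfolding R_def
    proof (rule fourth_power_sum_weighted_le)
      show "cmod \<alpha> * (p * q) \<le> m * (norm a * norm b) + c"
        unfolding p_def q_def m_def c_def by (rule Buzano_generalized[OF that])
      show "(p\<^sup>2 + q\<^sup>2)\<^sup>2 \<le> norm a ^ 4 + norm b ^ 4 + 2 * c\<^sup>2"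
        unfolding p_def q_def c_def by (rule sum_square_cinner_le[OF that])
      show "c \<le> norm a * norm b" unfolding c_def by (rule cmod_cinner_le)
      \<comment> \<open>Moving \<open>X\<close> and \<open>Y\<close> across the inner product pairs
        \<open>S y\<close> with \<open>cadjoint X x\<close> and \<open>T x\<close> with
        \<open>cadjoint Y y\<close>.\<close>
      have "cinner (op_matrix (\<lambda>_. 0) (X \<circ> S) (Y \<circ> T) (\<lambda>_. 0) z) z = cinner a b"
        by (simp add: z a_def b_def cinner_prod_def cinner_cadjoint_right)
      then show "c \<le> ?w"
        unfolding c_def using cinner_le_numerical_radius[OF OD that] by simp
      \<comment> \<open>The four squares are regrouped by argument: \<open>T\<close> with
        \<open>cadjoint X\<close> at \<open>x\<close>, and \<open>S\<close> with
        \<open>cadjoint Y\<close> at \<open>y\<close>.\<close>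
      have "(norm a)\<^sup>2 + (norm b)\<^sup>2 \<le> ?Tt * (norm x)\<^sup>2 + ?St * (norm y)\<^sup>2"
        using norm_sum_op_abs_le[of T "cadjoint X" x] norm_sum_op_abs_le[of S "cadjoint Y" y]
        by (simp add: na nb)
      also have "\<dots> \<le> N2 * (norm x)\<^sup>2 + N2 * (norm y)\<^sup>2"
        by (intro add_mono mult_right_mono) (simp_all add: N2_def)
      finally show "(norm a)\<^sup>2 + (norm b)\<^sup>2 \<le> N2" using xy by (simp flip: distrib_left)
      \<comment> \<open>Squaring \<open>(norm a)^2\<close> mixes \<open>x\<close> and
        \<open>y\<close>. Cauchy-Schwarz with the weights \<open>norm x\<close> and
        \<open>norm y\<close> separates them again, so that the regrouping by argument works for
        fourth powers too.\<close>
      have fourth: "((norm (A x))\<^sup>2 + (norm (B y))\<^sup>2)\<^sup>2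
          \<le> (norm ((op_abs A ^^ 2) x))\<^sup>2 + (norm ((op_abs B ^^ 2) y))\<^sup>2"
        if "bounded_clinear A" "bounded_clinear B" for A B :: "'a \<Rightarrow> 'a"
      proof -
        have "((norm (A x))\<^sup>2 + (norm (B y))\<^sup>2)\<^sup>2
            \<le> (norm ((op_abs A ^^ 2) x) * norm x + norm ((op_abs B ^^ 2) y) * norm y)\<^sup>2"
          using norm_power2_le_op_abs[OF that(1), of x] norm_power2_le_op_abs[OF that(2), of y]
          by (intro power_mono add_mono) simp_all
        also have "\<dots> \<le> (norm ((op_abs A ^^ 2) x))\<^sup>2 + (norm ((op_abs B ^^ 2) y))\<^sup>2"
          by (rule power2_sum_mult_le[OF xy])
        finally show ?thesis .
      qed
      have "norm a ^ 4 + norm b ^ 4 = ((norm a)\<^sup>2)\<^sup>2 + ((norm b)\<^sup>2)\<^sup>2"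
        by simp
      also have "\<dots> \<le> ?Tf * (norm x)\<^sup>2 + ?Sf * (norm y)\<^sup>2"
        unfolding na nb
        using fourth[of T S] fourth[of "cadjoint X" "cadjoint Y"]
          norm_sum_op_abs2_le[of T "cadjoint X" x] norm_sum_op_abs2_le[of S "cadjoint Y" y]
        by (simp add: add.commute)
      also have "\<dots> \<le> N4 * (norm x)\<^sup>2 + N4 * (norm y)\<^sup>2"
        by (intro add_mono mult_right_mono) (simp_all add: N4_def)
      finally show "norm a ^ 4 + norm b ^ 4 \<le> N4" using xy by (simp flip: distrib_left)
    qed (use assms m in \<open>simp_all add: p_def q_def c_def m2 flip: m_def\<close>)
    finally show ?thesis .
  qed
  \<comment> \<open>The supremum defining the radius is over first powers, so the pointwise bound
    passes through the fourth root.\<close>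
  have "?wM \<le> root 4 R"
  proof (rule numerical_radius_le)
    show "cmod (cinner (op_matrix T X Y S z) z) \<le> root 4 R" if "norm z = 1" for z
      using real_root_le_mono[OF _ main[OF that], of 4] by (simp add: real_root_power_cancel)
  qed (simp add: \<open>0 \<le> R\<close>)
  moreover have "0 \<le> ?wM"
    by (intro numerical_radius_nonneg bounded_linear_op_matrix) simp_all
  ultimately have "?wM ^ 4 \<le> root 4 R ^ 4" by (rule power_mono)
  then show ?thesis using \<open>0 \<le> R\<close> by (simp add: R_def N2_def N4_def)
qed

end
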